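(* Let $I$ be a (possibly infinite) set, $n\geq 1$, and let $A_{ij},B_{ij}\in\mathbb{R}\cup\{-\infty\}$ for $i\in I$, $j\in[n]$. Assume that for every $j\in[n]$ there exists $i\in I$ such that $A_{ij}\neq-\infty$. Then the system of tropical linear inequalities $$\max_{j\in[n]}(A_{ij}+x_j)\leq\max_{j\in[n]}(B_{ij}+x_j),\qquad i\in I,$$ has a solution $x\in(\mathbb{R}\cup\{-\infty\})^n$ that is not identically $-\infty$ if and only if Player Max has a winning state in the mean payoff game with dynamic programming operator $f=A^\sharp B$, i.e., if and only if $\bar\chi(f)\geq 0$.
   Context: Write $[n]=\{1,\dots,n\}$. The operator $B:(\mathbb{R}\cup\{-\infty\})^n\to(\mathbb{R}\cup\{-\infty\})^I$ is $(Bx)_i=\max_{j\in[n]}(B_{ij}+x_j)$, and the operator $A^\sharp:(\mathbb{R}\cup\{\pm\infty\})^I\to(\mathbb{R}\cup\{\pm\infty\})^n$ is $(A^\sharp y)_j=\inf_{i\in I}(-A_{ij}+y_i)$, with the convention $(+\infty)+(-\infty)=+\infty$. The map $f=A^\sharp B$ is $f_j(x)=\inf_{i\in I}\bigl(-A_{ij}+\max_{k\in[n]}(B_{ik}+x_k)\bigr)$; under the stated assumption it maps $(\mathbb{R}\cup\{-\infty\})^n$ to itself. Game interpretation: two players, Max and Min, alternate moves on the state space given by the disjoint union of $I$ and $[n]$. In state $j\in[n]$, Min chooses $i\in I$ with $A_{ij}\neq-\infty$, moves to $i$ and receives $A_{ij}$ from Max; in state $i\in I$, Max chooses $j\in[n]$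 with $B_{ij}\neq-\infty$, moves to $j$ and receives $B_{ij}$ from Min (if a player has no available action, that player pays an infinite amount to the other and the game terminates). $f^N_j(0)$ is the value for Max of the $N$-turn game starting from $j\in [n]$, where $f^N$ is the $N$-th iterate of $f$. The quantity $\bar\chi(f):=\lim_{N\to\infty}\max_{j\in[n]}f^N_j(x)/N\in\mathbb{R}\cup\{-\infty\}$ exists and is independent of the choice of $x\in\mathbb{R}^n$. By definition, Player Max has a winning state (winning position) when $\bar\chi(f)\geq0$. *)

theory Defs
  imports "HOL-Library.Extended_Real"
begin

text \<open>
  The tropical scalars are modelled in \<^typ>\<open>ereal\<close>. Its addition satisfies
  \<open>\<infinity> + (-\<infinity>) = \<infinity>\<close>, which is the convention needed for the residuated operator below.
  The index set \<open>[n]\<close> with \<open>n \<ge> 1\<close> is a finite (hence nonempty) type.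
\<close>

definition trop_apply :: "('i \<Rightarrow> 'n::finite \<Rightarrow> ereal) \<Rightarrow> ('n \<Rightarrow> ereal) \<Rightarrow> 'i \<Rightarrow> ereal"
  where "trop_apply B x i = (MAX j. B i j + x j)"

definition trop_sharp :: "'i set \<Rightarrow> ('i \<Rightarrow> 'n::finite \<Rightarrow> ereal) \<Rightarrow> ('i \<Rightarrow> ereal) \<Rightarrow> 'n \<Rightarrow> ereal"
  where "trop_sharp I A y j = (INF i\<in>I. - A i j + y i)"

definition game_operator ::
    "'i set \<Rightarrow> ('i \<Rightarrow> 'n::finite \<Rightarrow> ereal) \<Rightarrow> ('i \<Rightarrow> 'n \<Rightarrow> ereal) \<Rightarrow> ('n \<Rightarrow> ereal) \<Rightarrow> 'n \<Rightarrow> ereal"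
  where "game_operator I A B = trop_sharp I A \<circ> trop_apply B"

text \<open>
  The common value, over all finite starting vectors \<open>x\<close>, of the limit of
  \<open>max\<^sub>j f\<^sup>N\<^sub>j(x) / N\<close>. For game operators satisfying the standing assumption on \<open>A\<close>
  this limit exists and does not depend on \<open>x\<close>.
\<close>

definition chi_bar :: "(('n::finite \<Rightarrow> ereal) \<Rightarrow> 'n \<Rightarrow> ereal) \<Rightarrow> ereal"
  where "chi_bar f =
    (THE c. \<forall>x :: 'n \<Rightarrow> real.
       (\<lambda>N. (MAX j. (f ^^ N) (\<lambda>k. ereal (x k)) j) / ereal (real N)) \<longlonglongrightarrow> c)"

definition max_has_winning_state :: "(('n::finite \<Rightarrow> ereal) \<Rightarrow> 'n \<Rightarrow> ereal) \<Rightarrow> bool"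
  where "max_has_winning_state f \<longleftrightarrow> chi_bar f \<ge> 0"

end

theory Submission
  imports Defs "HOL-Analysis.Extended_Real_Limits"
begin

text \<open>
  Write \<open>f\<close> for the game operator. Residuation turns the system of inequalities into
  \<open>x \<le> f x\<close> (\<open>x\<close> is subinvariant); what remains is to relate this to the growth rate of \<open>f\<close>. Only
  three properties of \<open>f\<close> matter for most of the argument: it is monotone, it commutes with
  adding a real constant, and it creates no \<open>\<infinity>\<close> (locale \<open>topical_map\<close>).

  They make \<open>max\<^sub>j f\<^sup>N\<^sub>j(0)\<close> subadditive in \<open>N\<close>. By Fekete's lemma the growth rate exists
  and is the infimum of the averages \<open>max\<^sub>j f\<^sup>N\<^sub>j(0) / N\<close> (\<open>chi_bar_eq_INF\<close>). If \<open>x\<close> is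
  subinvariant, its iterates increase and stay below those of a finite vector, so the rate is
  nonnegative.

  Conversely, a nonnegative rate means that \<open>max\<^sub>j f\<^sup>N\<^sub>j(0) \<ge> 0\<close> for every \<open>N\<close>, precisely
  because the rate is an infimum. A maximum of finitely many iterates of \<open>0\<close>, with a small
  upward drift added, is then subinvariant up to errors that vanish after normalisation
  (\<open>almost_subinvariant\<close>). A subsequence of these vectors converges coordinatewise in
  \<open>[-\<infinity>, 0]\<close>, and its limit is subinvariant since \<open>f\<close> is an infimum of continuous functions.
\<close>

section \<open>Subadditive sequences\<close>

text \<open>
  Division with remainder, \<open>n = q p + r\<close>: the \<open>q\<close> blocks of length \<open>p\<close> contribute slope \<open>c\<close>, and the
  finitely many possible remainders contribute a bounded error.
\<close>

lemma subadditive_linear_bound: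
  fixes u :: "nat \<Rightarrow> ereal"
  assumes sub: "\<And>m n. u (m + n) \<le> u m + u n"
    and fin: "\<And>n. u n \<noteq> \<infinity>"
    and p: "0 < p" "u p \<le> ereal (real p * c)"
  obtains K where "\<And>n. u n \<le> ereal (real n * c + K)"
proof -
  have "\<exists>b. u r \<le> ereal b" for r
    using fin[of r] by (cases "u r") auto
  then obtain b where b: "\<And>r. u r \<le> ereal (b r)"
    by metis
  define K where "K = (\<Sum>r<p. \<bar>b r\<bar> + \<bar>real r * c\<bar>)"
  have multiples: "u (q * p + r) \<le> ereal (real q * (real p * c)) + u r" for q r
  proof (induction q)
    case 0
    then show ?case by simp
  next
    case (Suc q)
    have "u (Suc q * p + r) \<le> u p + u (q * p + r)"
      using sub[of p "q * p + r"] by (simp add: add.assoc)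
    also have "\<dots> \<le> ereal (real p * c) + (ereal (real q * (real p * c)) + u r)"
      by (intro add_mono p Suc.IH)
    also have "\<dots> = ereal (real (Suc q) * (real p * c)) + u r"
      by (simp add: distrib_right flip: add.assoc)
    finally show ?case .
  qed
  have "u n \<le> ereal (real n * c + K)" for n
  proof -
    define q r where "q = n div p" and "r = n mod p"
    have n: "n = q * p + r" and r: "r < p"
      using p by (simp_all add: q_def r_def)
    have "\<bar>b r\<bar> + \<bar>real r * c\<bar> \<le> K"
      unfolding K_def using r by (intro member_le_sum) auto
    then have "real q * (real p * c) + b r \<le> real n * c + K"
      by (simp add: n distrib_right mult.assoc)
    moreover have "u n \<le> ereal (real q * (real p * c)) + ereal (b r)"
      unfolding n by (rule order_trans[OF multiples add_left_mono[OF b]])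
    ultimately show ?thesis
      by (metis ereal_less_eq(3) order_trans plus_ereal.simps(1))
  qed
  then show thesis by (rule that)
qed

text \<open>
  Fekete's lemma: by the preceding bound, one small average \<open>u p / p\<close> makes all later averages
  small, up to an error \<open>K / n\<close>. A term \<open>-\<infinity>\<close> or a limit \<open>-\<infinity>\<close> falls under the same
  argument, because \<open>c\<close> is chosen strictly above the infimum and is thus always a real number.
\<close>

lemma subadditive_tendsto_INF:
  fixes u :: "nat \<Rightarrow> ereal"
  assumes sub: "\<And>m n. u (m + n) \<le> u m + u n"
    and fin: "\<And>n. u n \<noteq> \<infinity>"
  shows "(\<lambda>n. u n / ereal (real n)) \<longlonglongrightarrow> (INF n\<in>{1..}. u n / ereal (real n))"
    (is "_ \<longlonglongrightarrow> ?L")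
proof (rule order_tendstoI)
  fix a assume a: "a < ?L"
  have "a < u n / ereal (real n)" if "1 \<le> n" for n
    using a that by (intro less_le_trans[OF a] INF_lower) auto
  then show "\<forall>\<^sub>F n in sequentially. a < u n / ereal (real n)"
    unfolding eventually_sequentially by blast
next
  fix a assume "?L < a"
  then obtain c' where c': "?L < ereal c'" "ereal c' < a"
    using ereal_dense2 by blast
  then obtain c where c: "?L < ereal c" "ereal c < ereal c'"
    using ereal_dense2 by blast
  then obtain p where p: "1 \<le> p" "u p / ereal (real p) < ereal c"
    by (auto simp: INF_less_iff)
  have "u p \<le> ereal (real p * c)"
    using p fin[of p] by (cases "u p") (auto simp: field_simps)
  then obtain K where K: "\<And>n. u n \<le> ereal (real n * c + K)"
    using subadditive_linear_bound[of u p c, OF sub fin] p by auto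
  have "(\<lambda>n. K / real n) \<longlonglongrightarrow> 0"
    by (rule lim_const_over_n)
  then have "\<forall>\<^sub>F n in sequentially. K / real n < c' - c"
    using c by (intro order_tendstoD) auto
  moreover have "\<forall>\<^sub>F n in sequentially. 1 \<le> n"
    by (rule eventually_ge_at_top)
  ultimately show "\<forall>\<^sub>F n in sequentially. u n / ereal (real n) < a"
  proof eventually_elim
    case (elim n)
    have "u n / ereal (real n) \<le> ereal (real n * c + K) / ereal (real n)"
      using elim by (intro ereal_divide_right_mono K) auto
    also have "\<dots> < ereal c'"
      using elim by (simp add: field_simps)
    finally show ?case using c' by simp
  qed
qed

section \<open>Monotone additively homogeneous maps\<close>

locale topical_map =
  fixes f :: "('n::finite \<Rightarrow> ereal) \<Rightarrow> 'n \<Rightarrow> ereal"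
  assumes mono: "x \<le> y \<Longrightarrow> f x \<le> f y"
    and shift: "f (\<lambda>j. x j + ereal c) = (\<lambda>j. f x j + ereal c)"
    and not_PInf: "(\<And>j. x j \<noteq> \<infinity>) \<Longrightarrow> f x j \<noteq> \<infinity>"
begin

definition peak :: "('n \<Rightarrow> ereal) \<Rightarrow> nat \<Rightarrow> ereal"
  where "peak x N = (MAX j. (f ^^ N) x j)"

lemma funpow_mono: "x \<le> y \<Longrightarrow> (f ^^ N) x \<le> (f ^^ N) y"
  by (induction N) (auto intro: mono)

lemma funpow_shift: "(f ^^ N) (\<lambda>j. x j + ereal c) = (\<lambda>j. (f ^^ N) x j + ereal c)"
  by (induction N) (auto simp: shift)

lemma funpow_not_PInf: "(\<And>j. x j \<noteq> \<infinity>) \<Longrightarrow> (f ^^ N) x j \<noteq> \<infinity>"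
  by (induction N arbitrary: j) (auto intro!: not_PInf)

lemma le_peak: "(f ^^ N) x j \<le> peak x N"
  unfolding peak_def by (rule Max_ge) auto

lemma peak_attained: obtains j where "peak x N = (f ^^ N) x j"
proof -
  have "peak x N \<in> range ((f ^^ N) x)"
    unfolding peak_def by (rule Max_in) auto
  then show thesis using that by auto
qed

lemma peak_not_PInf: "(\<And>j. x j \<noteq> \<infinity>) \<Longrightarrow> peak x N \<noteq> \<infinity>"
  by (metis peak_attained funpow_not_PInf)

lemma peak_mono: "x \<le> y \<Longrightarrow> peak x N \<le> peak y N"
  by (metis peak_attained funpow_mono le_peak le_funD order_trans)

lemma peak_shift: "peak (\<lambda>j. x j + ereal c) N = peak x N + ereal c"
proof (rule antisym)
  show "peak (\<lambda>j. x j + ereal c) N \<le> peak x N + ereal c"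
    by (metis (no_types, lifting) peak_attained funpow_shift le_peak add_right_mono)
  show "peak x N + ereal c \<le> peak (\<lambda>j. x j + ereal c) N"
    by (metis (no_types, lifting) peak_attained funpow_shift le_peak)
qed

text \<open>
  After \<open>n\<close> steps every coordinate lies below the constant vector \<open>peak 0 n\<close>, and the
  remaining \<open>m\<close> steps commute with adding this constant. If the constant is \<open>-\<infinity>\<close>, then
  arbitrarily negative real constants can be used in its place, and the left-hand side is
  \<open>-\<infinity>\<close>, too.
\<close>

lemma peak_subadditive: "peak (\<lambda>_. 0) (m + n) \<le> peak (\<lambda>_. 0) m + peak (\<lambda>_. 0) n"
proof -
  have step: "peak (\<lambda>_. 0) (m + n) \<le> peak (\<lambda>_. 0) m + ereal c"
    if c: "peak (\<lambda>_. 0) n \<le> ereal c" for c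
  proof -
    have "(f ^^ n) (\<lambda>_. 0) \<le> (\<lambda>_. 0 + ereal c)"
      using le_peak c by (auto simp: le_fun_def intro: order_trans)
    then have "peak ((f ^^ n) (\<lambda>_. 0)) m \<le> peak (\<lambda>_. 0 + ereal c) m"
      by (rule peak_mono)
    also have "\<dots> = peak (\<lambda>_. 0) m + ereal c"
      by (rule peak_shift)
    finally show ?thesis by (simp add: peak_def funpow_add)
  qed
  show ?thesis
  proof (cases "peak (\<lambda>_. 0) n")
    case (real c)
    then show ?thesis using step by simp
  next
    case PInf
    then show ?thesis using peak_not_PInf[of "\<lambda>_. 0" n] by simp
  next
    case MInf
    have fin: "peak (\<lambda>_. 0) m \<noteq> \<infinity>" by (rule peak_not_PInf) simp
    have "peak (\<lambda>_. 0) (m + n) \<le> ereal b" for b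
    proof (cases "peak (\<lambda>_. 0) m")
      case (real d)
      then show ?thesis using step[of "b - d"] MInf by simp
    next
      case MInf': MInf
      then show ?thesis using step[of 0] MInf by simp
    qed (use fin in simp)
    then have "peak (\<lambda>_. 0) (m + n) = -\<infinity>"
      by (rule ereal_bot)
    then show ?thesis by simp
  qed
qed

lemma peak_zero_tendsto:
  "(\<lambda>N. peak (\<lambda>_. 0) N / ereal (real N)) \<longlonglongrightarrow> (INF N\<in>{1..}. peak (\<lambda>_. 0) N / ereal (real N))"
  by (intro subadditive_tendsto_INF peak_subadditive peak_not_PInf) simp

text \<open>
  Two finite starting vectors differ by at most a constant, hence so do all their iterates,
  and dividing by \<open>N\<close> makes the difference disappear.
\<close>

lemma peak_tendsto:
  fixes x :: "'n \<Rightarrow> real"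
  shows "(\<lambda>N. peak (\<lambda>j. ereal (x j)) N / ereal (real N))
    \<longlonglongrightarrow> (INF N\<in>{1..}. peak (\<lambda>_. 0) N / ereal (real N))" (is "_ \<longlonglongrightarrow> ?L")
proof -
  define C where "C = (\<Sum>j\<in>UNIV. \<bar>x j\<bar>)"
  have C: "\<bar>x j\<bar> \<le> C" for j
    unfolding C_def by (intro member_le_sum) auto
  have shifted: "(\<lambda>N. (peak (\<lambda>_. 0) N + ereal b) / ereal (real N)) \<longlonglongrightarrow> ?L" for b
  proof -
    have "(\<lambda>N. ereal (b / real N)) \<longlonglongrightarrow> ereal 0"
      using lim_const_over_n[of b] by (intro tendsto_intros)
    then have "(\<lambda>N. peak (\<lambda>_. 0) N / ereal (real N) + ereal (b / real N)) \<longlonglongrightarrow> ?L + ereal 0"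
      by (intro tendsto_add_ereal_general1 peak_zero_tendsto) auto
    then have "(\<lambda>N. peak (\<lambda>_. 0) N / ereal (real N) + ereal (b / real N)) \<longlonglongrightarrow> ?L"
      by simp
    moreover have "\<forall>\<^sub>F N in sequentially. peak (\<lambda>_. 0) N / ereal (real N) + ereal (b / real N)
        = (peak (\<lambda>_. 0) N + ereal b) / ereal (real N)"
      using eventually_gt_at_top[of 0]
    proof eventually_elim
      case (elim N)
      then show ?case by (cases "peak (\<lambda>_. 0) N") (auto simp: add_divide_distrib)
    qed
    ultimately show ?thesis
      by (rule Lim_transform_eventually)
  qed
  have lower: "peak (\<lambda>_. 0) N + ereal (- C) \<le> peak (\<lambda>j. ereal (x j)) N" for N
    unfolding peak_shift[symmetric]
  proof (intro peak_mono le_funI)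
    fix j show "0 + ereal (- C) \<le> ereal (x j)" using C[of j] by simp
  qed
  have upper: "peak (\<lambda>j. ereal (x j)) N \<le> peak (\<lambda>_. 0) N + ereal C" for N
    unfolding peak_shift[symmetric]
  proof (intro peak_mono le_funI)
    fix j show "ereal (x j) \<le> 0 + ereal C" using C[of j] by simp
  qed
  show ?thesis
  proof (rule tendsto_sandwich[OF _ _ shifted[of "- C"] shifted[of C]])
    show "\<forall>\<^sub>F N in sequentially. (peak (\<lambda>_. 0) N + ereal (- C)) / ereal (real N)
        \<le> peak (\<lambda>j. ereal (x j)) N / ereal (real N)"
      using eventually_gt_at_top[of 0]
      by eventually_elim (auto intro!: ereal_divide_right_mono lower)
    show "\<forall>\<^sub>F N in sequentially. peak (\<lambda>j. ereal (x j)) N / ereal (real N)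
        \<le> (peak (\<lambda>_. 0) N + ereal C) / ereal (real N)"
      using eventually_gt_at_top[of 0]
      by eventually_elim (auto intro!: ereal_divide_right_mono upper)
  qed
qed

lemma chi_bar_eq_INF: "chi_bar f = (INF N\<in>{1..}. peak (\<lambda>_. 0) N / ereal (real N))"
  unfolding chi_bar_def peak_def[symmetric]
proof (rule the_equality)
  show "\<forall>x::'n \<Rightarrow> real. (\<lambda>N. peak (\<lambda>j. ereal (x j)) N / ereal (real N))
      \<longlonglongrightarrow> (INF N\<in>{1..}. peak (\<lambda>_. 0) N / ereal (real N))"
    by (blast intro: peak_tendsto)
qed (blast intro: LIMSEQ_unique peak_tendsto)

lemma chi_bar_tendsto:
  fixes x :: "'n \<Rightarrow> real"
  shows "(\<lambda>N. peak (\<lambda>j. ereal (x j)) N / ereal (real N)) \<longlonglongrightarrow> chi_bar f"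
  unfolding chi_bar_eq_INF by (rule peak_tendsto)

section \<open>Subinvariant vectors and the growth rate\<close>

text \<open>
  The iterates of a subinvariant vector increase, so a finite coordinate stays bounded
  below. Replacing the entries \<open>-\<infinity>\<close> by \<open>0\<close> gives a finite starting vector, whose
  iterates dominate.
\<close>

lemma subinvariant_imp_chi_bar_nonneg:
  assumes sub: "x \<le> f x" and fin: "\<And>j. x j \<noteq> \<infinity>" and nontriv: "x j0 \<noteq> -\<infinity>"
  shows "0 \<le> chi_bar f"
proof -
  define y where "y j = real_of_ereal (x j)" for j
  have xy: "x \<le> (\<lambda>j. ereal (y j))"
  proof (rule le_funI)
    fix j show "x j \<le> ereal (y j)"
      using fin[of j] by (cases "x j") (auto simp: y_def)
  qed
  have x0: "x j0 = ereal (y j0)"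
    using fin[of j0] nontriv by (cases "x j0") (auto simp: y_def)
  have "x \<le> (f ^^ N) x" for N
  proof (induction N)
    case (Suc N)
    then show ?case using sub mono[of x "(f ^^ N) x"] by (auto intro: order_trans)
  qed simp
  then have bound: "ereal (y j0) \<le> peak (\<lambda>j. ereal (y j)) N" for N
    by (metis x0 le_funD le_peak peak_mono[OF xy] order_trans)
  have "(\<lambda>N. ereal (y j0 / real N)) \<longlonglongrightarrow> ereal 0"
    using lim_const_over_n[of "y j0"] by (intro tendsto_intros)
  moreover have "\<forall>\<^sub>F N in sequentially.
      ereal (y j0 / real N) \<le> peak (\<lambda>j. ereal (y j)) N / ereal (real N)"
    using eventually_gt_at_top[of 0]
  proof eventually_elim
    case (elim N)
    then show ?case
      using ereal_divide_right_mono[OF bound[of N], of "ereal (real N)"] by simp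
  qed
  ultimately have "ereal 0 \<le> chi_bar f"
    by (intro tendsto_le[OF _ chi_bar_tendsto[of y]]) auto
  then show ?thesis by (simp add: zero_ereal_def)
qed

lemma chi_bar_nonneg_imp_peak_nonneg:
  assumes "0 \<le> chi_bar f"
  shows "0 \<le> peak (\<lambda>_. 0) N"
proof (cases "N = 0")
  case True
  then show ?thesis by (simp add: peak_def)
next
  case False
  have "0 \<le> peak (\<lambda>_. 0) N / ereal (real N)"
    using assms False unfolding chi_bar_eq_INF by (auto simp: le_INF_iff)
  then show ?thesis
    using False by (cases "peak (\<lambda>_. 0) N") (auto simp: zero_le_divide_iff)
qed

text \<open>
  The maximum \<open>y\<close> of the vectors \<open>f\<^sup>k(0) + k/m\<close> with \<open>k \<le> m\<^sup>2\<close> satisfies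
  \<open>y \<le> max (f y + 1/m) 0\<close>, because \<open>f\<close> sends each of them to the next one, up to \<open>1/m\<close>,
  and only the vector \<open>0\<close> has no predecessor. The drift \<open>1/m\<close> and the length
  \<open>m\<^sup>2\<close> are chosen so that the drift vanishes as \<open>m\<close> grows while the last vector still
  forces \<open>max y \<ge> m\<close>. After subtracting \<open>max y\<close>, the error term \<open>0\<close> has become a
  number at most \<open>-m\<close>.
\<close>

lemma almost_subinvariant:
  assumes chi: "0 \<le> chi_bar f" and m: "0 < (m::nat)"
  obtains z j0 where "z \<le> (\<lambda>_. 0)" "z j0 = 0"
    "\<And>j. z j \<le> max (f z j + ereal (1 / real m)) (ereal (- real m))"
proof -
  define t where "t k j = (f ^^ k) (\<lambda>_. 0) j + ereal (real k / real m)" for k j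
  define y where "y j = (MAX k\<in>{..m * m}. t k j)" for j
  have t_le: "t k j \<le> y j" if "k \<le> m * m" for k j
    unfolding y_def using that by (intro Max_ge) auto
  have y_in: "\<exists>k\<le>m * m. y j = t k j" for j
  proof -
    have "y j \<in> (\<lambda>k. t k j) ` {..m * m}"
      unfolding y_def by (rule Max_in) auto
    then show ?thesis by auto
  qed
  have t_fin: "t k j \<noteq> \<infinity>" for k j
    using funpow_not_PInf[of "\<lambda>_. 0" k j] by (simp add: t_def)
  have y_ne: "\<bar>y j\<bar> \<noteq> \<infinity>" for j
    using y_in[of j] t_fin t_le[of 0 j] by (auto simp: t_def)
  have t_Suc: "t (Suc k) j = f (t k) j + ereal (1 / real m)" for k j
  proof -
    have "f (t k) = (\<lambda>j. f ((f ^^ k) (\<lambda>_. 0)) j + ereal (real k / real m))"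
      unfolding t_def by (rule shift)
    then have "f (t k) j + ereal (1 / real m)
        = f ((f ^^ k) (\<lambda>_. 0)) j + (ereal (real k / real m) + ereal (1 / real m))"
      by (simp only: add.assoc)
    moreover have "real (Suc k) / real m = real k / real m + 1 / real m"
      by (simp add: add_divide_distrib)
    ultimately show ?thesis
      unfolding t_def by simp
  qed
  have y_sub: "y j \<le> max (f y j + ereal (1 / real m)) 0" for j
  proof -
    obtain k where k: "k \<le> m * m" "y j = t k j" using y_in by blast
    show ?thesis
    proof (cases k)
      case 0
      then show ?thesis using k by (simp add: t_def)
    next
      case (Suc l)
      then have "t l \<le> y" using k t_le by (auto intro!: le_funI)
      then have "f (t l) j \<le> f y j" by (rule le_funD[OF mono])
      then show ?thesis
        using k Suc t_Suc add_right_mono[of "f (t l) j" "f y j" "ereal (1 / real m)"]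
        by (simp add: max.coboundedI1)
    qed
  qed
  have "Max (range y) \<in> range y"
    by (rule Max_in) auto
  then obtain j0 where "Max (range y) = y j0"
    by (rule rangeE)
  then have j0: "y j \<le> y j0" for j
    by (metis Max_ge finite_imageI finite rangeI)
  obtain c where c: "y j0 = ereal c"
    using y_ne[of j0] by auto
  obtain j1 where j1: "peak (\<lambda>_. 0) (m * m) = (f ^^ (m * m)) (\<lambda>_. 0) j1"
    by (rule peak_attained)
  have "ereal (real m) \<le> t (m * m) j1"
    using chi_bar_nonneg_imp_peak_nonneg[OF chi, of "m * m"] m
    by (simp add: t_def j1 add_increasing)
  also have "\<dots> \<le> y j0"
    using t_le j0 order_trans by blast
  finally have mc: "real m \<le> c" using c by simp
  define z where "z j = y j + ereal (- c)" for j
  have "z \<le> (\<lambda>_. 0)"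
  proof (rule le_funI)
    fix j show "z j \<le> 0"
      using add_right_mono[OF j0[of j], of "ereal (- c)"] by (simp add: z_def c zero_ereal_def)
  qed
  moreover have "z j0 = 0" by (simp add: z_def c)
  moreover have "z j \<le> max (f z j + ereal (1 / real m)) (ereal (- real m))" for j
  proof -
    have fz: "f z = (\<lambda>j. f y j + ereal (- c))"
      unfolding z_def by (rule shift)
    have "z j \<le> max (f y j + ereal (1 / real m)) 0 + ereal (- c)"
      unfolding z_def by (intro add_right_mono y_sub)
    also have "\<dots> \<le> max (f y j + ereal (1 / real m) + ereal (- c)) (ereal (- c))"
      by (cases "f y j + ereal (1 / real m) \<le> 0") (simp_all add: max.absorb1 max.absorb2)
    also have "f y j + ereal (1 / real m) + ereal (- c) = f z j + ereal (1 / real m)"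
      unfolding fz by (simp only: ac_simps)
    also have "max (f z j + ereal (1 / real m)) (ereal (- c))
        \<le> max (f z j + ereal (1 / real m)) (ereal (- real m))"
      using mc by (intro max.mono) auto
    finally show ?thesis .
  qed
  ultimately show thesis by (rule that)
qed

end

section \<open>Game operators and tropical linear inequalities\<close>

lemma INF_ereal_shift:
  fixes g :: "'i \<Rightarrow> ereal"
  shows "(INF i\<in>I. g i + ereal c) = (INF i\<in>I. g i) + ereal c"
proof (rule antisym)
  have le: "(INF i\<in>I. h i) + ereal d \<le> (INF i\<in>I. h i + ereal d)" for h :: "'i \<Rightarrow> ereal" and d
    by (intro INF_greatest add_right_mono INF_lower)
  show "(INF i\<in>I. g i) + ereal c \<le> (INF i\<in>I. g i + ereal c)"
    by (rule le)
  have "(INF i\<in>I. g i + ereal c) + ereal (- c) \<le> (INF i\<in>I. g i + ereal c + ereal (- c))"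
    by (rule le)
  also have "\<dots> = (INF i\<in>I. g i)"
    by (simp add: add.assoc)
  finally have "(INF i\<in>I. g i + ereal c) + ereal (- c) + ereal c \<le> (INF i\<in>I. g i) + ereal c"
    by (rule add_right_mono)
  then show "(INF i\<in>I. g i + ereal c) \<le> (INF i\<in>I. g i) + ereal c"
    by (simp add: add.assoc)
qed

lemma trop_apply_ge: "B i j + x j \<le> trop_apply B x i"
  unfolding trop_apply_def by (rule Max_ge) auto

lemma trop_apply_le_iff: "trop_apply B x i \<le> c \<longleftrightarrow> (\<forall>j. B i j + x j \<le> c)"
  unfolding trop_apply_def by (subst Max_le_iff) auto

lemma trop_apply_attained: obtains j where "trop_apply B x i = B i j + x j"
proof -
  have "trop_apply B x i \<in> range (\<lambda>j. B i j + x j)"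
    unfolding trop_apply_def by (rule Max_in) auto
  then show thesis using that by auto
qed

lemma trop_apply_mono: "x \<le> y \<Longrightarrow> trop_apply B x i \<le> trop_apply B y i"
  by (metis (no_types, lifting) trop_apply_attained trop_apply_ge add_left_mono le_funD order_trans)

lemma trop_apply_shift: "trop_apply B (\<lambda>j. x j + ereal c) i = trop_apply B x i + ereal c"
proof (rule antisym)
  show "trop_apply B (\<lambda>j. x j + ereal c) i \<le> trop_apply B x i + ereal c"
    unfolding trop_apply_le_iff
    by (auto simp: trop_apply_ge intro!: add_right_mono simp flip: add.assoc)
  show "trop_apply B x i + ereal c \<le> trop_apply B (\<lambda>j. x j + ereal c) i"
  proof -
    obtain j where "trop_apply B x i = B i j + x j" by (rule trop_apply_attained)
    then show ?thesis
      using trop_apply_ge[of B i j "\<lambda>j. x j + ereal c"] by (simp add: add.assoc)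
  qed
qed

lemma game_operator_apply:
  "game_operator I A B x j = (INF i\<in>I. - A i j + trop_apply B x i)"
  by (simp add: game_operator_def trop_sharp_def)

lemma topical_map_game_operator:
  fixes A B :: "'i \<Rightarrow> 'n::finite \<Rightarrow> ereal"
  assumes B: "\<And>i j. i \<in> I \<Longrightarrow> B i j \<noteq> \<infinity>"
    and A: "\<And>j. \<exists>i\<in>I. A i j \<noteq> -\<infinity>"
  shows "topical_map (game_operator I A B)"
proof
  fix x y :: "'n \<Rightarrow> ereal"
  assume "x \<le> y"
  then show "game_operator I A B x \<le> game_operator I A B y"
    by (intro le_funI) (auto simp: game_operator_apply intro!: INF_mono' add_left_mono trop_apply_mono)
next
  fix x :: "'n \<Rightarrow> ereal" and c
  show "game_operator I A B (\<lambda>j. x j + ereal c) = (\<lambda>j. game_operator I A B x j + ereal c)"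
    by (rule ext) (simp add: game_operator_apply trop_apply_shift INF_ereal_shift flip: add.assoc)
next
  fix x :: "'n \<Rightarrow> ereal" and j
  assume x: "\<And>j. x j \<noteq> \<infinity>"
  obtain i where i: "i \<in> I" "A i j \<noteq> -\<infinity>" using A by blast
  obtain k where "trop_apply B x i = B i k + x k" by (rule trop_apply_attained)
  then have "- A i j + trop_apply B x i \<noteq> \<infinity>"
    using B[OF i(1), of k] x[of k] i(2) by (simp add: ereal_uminus_eq_reorder)
  moreover have "game_operator I A B x j \<le> - A i j + trop_apply B x i"
    unfolding game_operator_apply using i(1) by (rule INF_lower)
  ultimately show "game_operator I A B x j \<noteq> \<infinity>" by auto
qed

text \<open>
  Residuation: with the convention \<open>\<infinity> + (-\<infinity>) = \<infinity>\<close>, a term \<open>a\<close> can be moved across an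
  inequality \<open>a + y \<le> z\<close> even for \<open>a = -\<infinity>\<close>, when both sides of the equivalence are true.
  For this reason the system of inequalities says exactly that \<open>x\<close> is subinvariant.
\<close>

lemma ereal_add_le_iff_residuated:
  fixes a y z :: ereal
  assumes "a \<noteq> \<infinity>" "y \<noteq> \<infinity>"
  shows "a + y \<le> z \<longleftrightarrow> y \<le> - a + z"
  using assms by (cases a; cases y; cases z) auto

lemma le_game_operator_iff:
  assumes A: "\<And>i j. i \<in> I \<Longrightarrow> A i j \<noteq> \<infinity>" and x: "\<And>j. x j \<noteq> \<infinity>"
  shows "x \<le> game_operator I A B x \<longleftrightarrow> (\<forall>i\<in>I. trop_apply A x i \<le> trop_apply B x i)"
proof -
  have "x \<le> game_operator I A B x \<longleftrightarrow> (\<forall>j. \<forall>i\<in>I. x j \<le> - A i j + trop_apply B x i)"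
    by (simp add: le_fun_def game_operator_apply le_INF_iff)
  also have "\<dots> \<longleftrightarrow> (\<forall>i\<in>I. trop_apply A x i \<le> trop_apply B x i)"
    unfolding trop_apply_le_iff using A x by (auto simp: ereal_add_le_iff_residuated)
  finally show ?thesis .
qed

lemma convergent_subsequence_finite_family:
  fixes z :: "nat \<Rightarrow> 'a \<Rightarrow> ereal"
  assumes "finite S"
  obtains r l where "strict_mono (r :: nat \<Rightarrow> nat)" "\<And>j. j \<in> S \<Longrightarrow> (\<lambda>n. z (r n) j) \<longlonglongrightarrow> l j"
proof -
  have "\<exists>r l. strict_mono (r :: nat \<Rightarrow> nat) \<and> (\<forall>j\<in>S. (\<lambda>n. z (r n) j) \<longlonglongrightarrow> l j)"
    using assms
  proof (induction S)
    case empty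
    show ?case using strict_mono_id by blast
  next
    case (insert a S)
    then obtain r l where r: "strict_mono (r :: nat \<Rightarrow> nat)"
      and l: "\<forall>j\<in>S. (\<lambda>n. z (r n) j) \<longlonglongrightarrow> l j" by blast
    obtain b s where s: "strict_mono (s :: nat \<Rightarrow> nat)" and b: "((\<lambda>n. z (r n) a) \<circ> s) \<longlonglongrightarrow> b"
      using compact_complete_linorder by blast
    have "(\<lambda>n. z ((r \<circ> s) n) j) \<longlonglongrightarrow> (l(a := b)) j" if "j \<in> insert a S" for j
    proof (cases "j = a")
      case True
      then show ?thesis using b by (simp add: comp_def)
    next
      case False
      then have "((\<lambda>n. z (r n) j) \<circ> s) \<longlonglongrightarrow> l j"
        using l that s by (intro LIMSEQ_subseq_LIMSEQ) auto
      then show ?thesis using False by (simp add: comp_def)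
    qed
    then show ?case using strict_mono_o[OF r s] by blast
  qed
  then show thesis using that by blast
qed

lemma frequently_le_imp_limit_le:
  fixes u v :: "nat \<Rightarrow> ereal"
  assumes "u \<longlonglongrightarrow> a" "v \<longlonglongrightarrow> b" "\<exists>\<^sub>F n in sequentially. u n \<le> v n"
  shows "a \<le> b"
proof (rule ccontr)
  assume "\<not> a \<le> b"
  then obtain c where c: "b < c" "c < a" using dense by (auto simp: not_le)
  have "\<forall>\<^sub>F n in sequentially. v n < c" "\<forall>\<^sub>F n in sequentially. c < u n"
    using order_tendstoD assms c by blast+
  then have "\<forall>\<^sub>F n in sequentially. \<not> u n \<le> v n"
    by eventually_elim auto
  then show False using assms(3) by (simp add: frequently_def)
qed

text \<open>
  Compactness of the extended half-line turns the almost subinvariant vectors into a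
  subinvariant one. Every inequality involves finitely many indices only, so one maximising
  index occurs infinitely often; this is why the inequality survives in the limit, where
  an infimum over infinitely many \<open>i\<close> need not be continuous. The coordinate in which
  the maximum \<open>0\<close> is attained is kept in the same way, which makes the limit nontrivial.
\<close>

lemma chi_bar_nonneg_imp_subinvariant:
  fixes A B :: "'i \<Rightarrow> 'n::finite \<Rightarrow> ereal"
  assumes A: "\<And>i j. i \<in> I \<Longrightarrow> A i j \<noteq> \<infinity>"
    and B: "\<And>i j. i \<in> I \<Longrightarrow> B i j \<noteq> \<infinity>"
    and A': "\<And>j. \<exists>i\<in>I. A i j \<noteq> -\<infinity>"
    and chi: "0 \<le> chi_bar (game_operator I A B)"
  obtains x j0 where "x \<le> (\<lambda>_. 0)" "x j0 = 0" "x \<le> game_operator I A B x"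
proof -
  let ?f = "game_operator I A B"
  interpret topical_map ?f by (rule topical_map_game_operator) (use B A' in auto)
  have "\<exists>z. z \<le> (\<lambda>_. 0) \<and> (\<exists>j0. z j0 = 0) \<and>
      (\<forall>j. z j \<le> max (?f z j + ereal (1 / real (Suc m))) (ereal (- real (Suc m))))" for m
    using almost_subinvariant[OF chi, of "Suc m"] by (metis zero_less_Suc)
  then obtain z where z_le: "\<And>m. z m \<le> (\<lambda>_. 0)" and z_0: "\<And>m. \<exists>j0. z m j0 = 0"
    and z_sub: "\<And>m j. z m j \<le> max (?f (z m) j + ereal (1 / real (Suc m))) (ereal (- real (Suc m)))"
    by metis
  obtain r x where r: "strict_mono (r :: nat \<Rightarrow> nat)" and x: "\<And>j. (\<lambda>n. z (r n) j) \<longlonglongrightarrow> x j"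
    using convergent_subsequence_finite_family[of "UNIV :: 'n set" z] by auto
  have r_top: "filterlim r sequentially sequentially"
    using r by (rule filterlim_subseq)
  have x_le: "x \<le> (\<lambda>_. 0)"
    by (intro le_funI LIMSEQ_le_const2[OF x]) (use z_le in \<open>auto simp: le_fun_def\<close>)
  have "\<exists>\<^sub>F n in sequentially. \<exists>j\<in>UNIV. z (r n) j = 0"
    using z_0 by simp
  then obtain j0 where "\<exists>\<^sub>F n in sequentially. z (r n) j0 = 0"
    using frequently_bex_finite[of "UNIV :: 'n set" "\<lambda>n j. z (r n) j = 0" sequentially] by auto
  then have "\<exists>\<^sub>F n in sequentially. 0 \<le> z (r n) j0"
    by (rule frequently_elim1) simp
  then have "0 \<le> x j0"
    by (rule frequently_le_imp_limit_le[OF tendsto_const x])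
  then have x_0: "x j0 = 0" using x_le by (auto simp: le_fun_def intro: antisym)
  have "x j \<le> - A i j + trop_apply B x i" if i: "i \<in> I" for i j
  proof (cases "A i j")
    case MInf
    then show ?thesis by simp
  next
    case PInf
    then show ?thesis using A[OF i] by simp
  next
    case (real a)
    \<comment> \<open>The bound for \<open>z (r n) j\<close> if the maximum in row \<open>i\<close> is attained at \<open>k\<close>.\<close>
    define w where "w k n = max (B i k + z (r n) k + ereal (1 / real (Suc (r n)) - a))
      (ereal (- real (Suc (r n))))" for k n
    have "\<exists>k\<in>UNIV. z (r n) j \<le> w k n" for n
    proof -
      obtain k where k: "trop_apply B (z (r n)) i = B i k + z (r n) k"
        by (rule trop_apply_attained)
      have "?f (z (r n)) j \<le> - A i j + trop_apply B (z (r n)) i"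
        unfolding game_operator_apply using i by (rule INF_lower)
      also have "\<dots> = B i k + z (r n) k + ereal (- a)"
        using real k by (simp add: add.commute)
      finally have "?f (z (r n)) j + ereal (1 / real (Suc (r n)))
          \<le> B i k + z (r n) k + ereal (- a) + ereal (1 / real (Suc (r n)))"
        by (rule add_right_mono)
      then have "?f (z (r n)) j + ereal (1 / real (Suc (r n)))
          \<le> B i k + z (r n) k + ereal (1 / real (Suc (r n)) - a)"
        by (simp add: add.assoc)
      then have "z (r n) j \<le> w k n"
        unfolding w_def by (intro order_trans[OF z_sub] max.mono) auto
      then show ?thesis by blast
    qed
    then obtain k where k: "\<exists>\<^sub>F n in sequentially. z (r n) j \<le> w k n"
      using frequently_bex_finite[of "UNIV :: 'n set" "\<lambda>n k. z (r n) j \<le> w k n" sequentially]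
      by auto
    have "(\<lambda>n. 1 / real (Suc n) - a) \<longlonglongrightarrow> 0 - a"
      by (intro tendsto_diff tendsto_const LIMSEQ_Suc[OF lim_const_over_n])
    then have eps: "(\<lambda>n. ereal (1 / real (Suc (r n)) - a)) \<longlonglongrightarrow> ereal (- a)"
      using filterlim_compose[OF _ r_top] by (intro tendsto_intros) force
    have "filterlim (\<lambda>n. real (Suc n)) at_top sequentially"
      by (rule filterlim_compose[OF filterlim_real_sequentially filterlim_Suc])
    then have "(\<lambda>n. - ereal (real (Suc n))) \<longlonglongrightarrow> - \<infinity>"
      by (intro tendsto_uminus_ereal) (simp add: tendsto_PInfty_eq_at_top)
    then have small: "(\<lambda>n. ereal (- real (Suc (r n)))) \<longlonglongrightarrow> - \<infinity>"
      using filterlim_compose[OF _ r_top] by fastforce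
    have "(\<lambda>n. B i k + z (r n) k) \<longlonglongrightarrow> B i k + x k"
    proof (cases "B i k")
      case (real b)
      then show ?thesis using x by (intro tendsto_add_ereal_general2) auto
    next
      case MInf
      \<comment> \<open>The constant \<open>-\<infinity>\<close> absorbs everything except \<open>\<infinity>\<close>, so both sides are \<open>-\<infinity>\<close>.\<close>
      have "z m k \<noteq> \<infinity>" for m
        using z_le[of m] by (auto simp: le_fun_def dest: spec[of _ k])
      moreover have "x k \<noteq> \<infinity>"
        using x_le by (auto simp: le_fun_def dest: spec[of _ k])
      ultimately have "B i k + z m k = - \<infinity>" "B i k + x k = - \<infinity>" for m
        using MInf by simp_all
      then show ?thesis by (simp only: tendsto_const)
    qed (use B[OF i] in simp)
    then have "(\<lambda>n. B i k + z (r n) k + ereal (1 / real (Suc (r n)) - a))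
        \<longlonglongrightarrow> B i k + x k + ereal (- a)"
      by (rule tendsto_add_ereal_general1[rotated, OF _ eps]) simp
    then have "w k \<longlonglongrightarrow> max (B i k + x k + ereal (- a)) (- \<infinity>)"
      unfolding w_def using small by (rule tendsto_max)
    then have "x j \<le> max (B i k + x k + ereal (- a)) (- \<infinity>)"
      using frequently_le_imp_limit_le[OF x _ k] by blast
    also have "\<dots> \<le> trop_apply B x i + ereal (- a)"
      using add_right_mono[OF trop_apply_ge[of B i k x], of "ereal (- a)"] by simp
    finally show ?thesis using real by (simp add: add.commute)
  qed
  then have "x \<le> ?f x"
    by (auto simp: le_fun_def game_operator_apply intro: INF_greatest)
  then show thesis using x_le x_0 that by blast
qed

theorem theorem3p1:
  fixes I :: "'i set"
    and A B :: "'i \<Rightarrow> 'n::finite \<Rightarrow> ereal"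
  assumes "\<And>i j. i \<in> I \<Longrightarrow> A i j \<noteq> \<infinity>"
    and "\<And>i j. i \<in> I \<Longrightarrow> B i j \<noteq> \<infinity>"
    and "\<And>j. \<exists>i\<in>I. A i j \<noteq> -\<infinity>"
  shows "(\<exists>x :: 'n \<Rightarrow> ereal. (\<forall>j. x j \<noteq> \<infinity>) \<and> (\<exists>j. x j \<noteq> -\<infinity>) \<and>
            (\<forall>i\<in>I. (MAX j. A i j + x j) \<le> (MAX j. B i j + x j)))
         \<longleftrightarrow> max_has_winning_state (game_operator I A B)"
  unfolding max_has_winning_state_def trop_apply_def[symmetric]
proof
  interpret topical_map "game_operator I A B"
    by (rule topical_map_game_operator) (use assms in auto)
  assume "\<exists>x. (\<forall>j. x j \<noteq> \<infinity>) \<and> (\<exists>j. x j \<noteq> -\<infinity>) \<and>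
      (\<forall>i\<in>I. trop_apply A x i \<le> trop_apply B x i)"
  then obtain x j0 where x: "\<And>j. x j \<noteq> \<infinity>" "x j0 \<noteq> -\<infinity>"
    and sol: "\<forall>i\<in>I. trop_apply A x i \<le> trop_apply B x i" by blast
  have "x \<le> game_operator I A B x"
    using le_game_operator_iff[of I A x B] assms(1) x(1) sol by blast
  then show "0 \<le> chi_bar (game_operator I A B)"
    using x by (rule subinvariant_imp_chi_bar_nonneg)
next
  assume "0 \<le> chi_bar (game_operator I A B)"
  then obtain x j0 where x: "x \<le> (\<lambda>_. 0)" "x j0 = 0" and sub: "x \<le> game_operator I A B x"
    using chi_bar_nonneg_imp_subinvariant[of I A B] assms by blast
  have fin: "x j \<noteq> \<infinity>" for j
    using x(1) by (auto simp: le_fun_def dest: spec[of _ j])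
  have "\<forall>i\<in>I. trop_apply A x i \<le> trop_apply B x i"
    using le_game_operator_iff[of I A x B] assms(1) fin sub by blast
  moreover have "x j0 \<noteq> -\<infinity>" using x(2) by simp
  ultimately show "\<exists>x. (\<forall>j. x j \<noteq> \<infinity>) \<and> (\<exists>j. x j \<noteq> -\<infinity>) \<and>
      (\<forall>i\<in>I. trop_apply A x i \<le> trop_apply B x i)"
    using fin by blast
qed

end
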